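(* Let $\{Y_n\}_{n\in\mathbb{Z}}$, $Y_n=(Y_{1,n},Y_{2,n})^T$, be a zero-mean, real, second-order stationary bivariate series whose matrix autocovariance function $\gamma_Y(h)=\mathbb{E}Y_{n+h}Y_n^T=(\gamma_{Y,jk}(h))_{j,k=1,2}$ satisfies $$\gamma_{Y,11}(h)=\gamma_{Y,22}(h),\qquad \gamma_{Y,12}(h)=-\gamma_{Y,21}(h)\qquad\text{for all }h\in\mathbb{Z},$$ and which has long memory with limiting form, for some $d\in(0,1/2)$, $r_0>0$, $r_1\in\mathbb{R}$, $$\gamma_Y(h)\sim\begin{pmatrix} r_0&-r_1\\ r_1&r_0\end{pmatrix}h^{2d-1},\qquad h\to\infty .$$ Let $\lambda_0\in(0,\pi)$ and $$X_n=\cos(\lambda_0 n)Y_{1,n}+\sin(\lambda_0 n)Y_{2,n},\qquad n\in\mathbb{Z}.$$ Then $\{X_n\}_{n\in\mathbb{Z}}$ is second-order stationary, its autocovariance function satisfies $$\gamma_X(h)=\cos(\lambda_0h)\gamma_{Y,11}(h)-\sin(\lambda_0h)\gamma_{Y,12}(h),\qquad h\in\mathbb{Z},$$ and $\{X_n\}$ exhibits cyclical long memory with the same $\lambda_0$ (and memory parameter $d$), namely $$\gamma_X(h)=c_\gamma\cos(\lambda_0h+\phi)h^{2d-1}+o(h^{2d-1}),\quad h\to\infty,$$ with $$c_\gamma=\sqrt{r_0^2+r_1^2},\qquad \phi=\arcsin\left(\frac{-r_1}{\sqrt{r_0^2+r_1^2}}\right).$$ Equivalently, $r_0=c_\gamma\cos(\phi)$,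 $r_1=-c_\gamma\sin(\phi)$.
   Context: The matrix relation $\gamma_Y(h)\sim R\,h^{2d-1}$ is understood entrywise: $\gamma_{Y,jk}(h)=R_{jk}h^{2d-1}+o(h^{2d-1})$ as $h\to\infty$ (so a zero coefficient means $o(h^{2d-1})$). A second-order stationary zero-mean series $X$ with autocovariance function $\gamma_X(h)=\mathbb{E}X_{n+h}X_n$ exhibits cyclical long memory with memory parameter $d\in(0,1/2)$, cyclical frequency $\lambda_0\in(0,\pi)$ and cyclical phase $\phi\in(-\pi/2,\pi/2)$ if $\gamma_X(h)=c_\gamma\cos(\lambda_0h+\phi)h^{2d-1}+o(h^{2d-1})$ as $h\to\infty$ for some $c_\gamma>0$. *)

theory Defs
  imports "HOL-Probability.Probability"
begin

text \<open>
  Series indexed by the integers. Autocovariances are uncentred second moments, so they are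
  the usual ones for zero-mean series. They are evaluated at the time pair \<open>(h, 0)\<close>; under
  second-order stationarity every pair \<open>(n + h, n)\<close> gives the same value.
\<close>

definition second_order_stationary :: "'a measure \<Rightarrow> (int \<Rightarrow> 'a \<Rightarrow> real) \<Rightarrow> bool" where
  "second_order_stationary M X \<longleftrightarrow>
     (\<forall>n. X n \<in> borel_measurable M) \<and>
     (\<forall>n. integrable M (\<lambda>\<omega>. (X n \<omega>)\<^sup>2)) \<and>
     (\<exists>\<mu>. \<forall>n. (\<integral>\<omega>. X n \<omega> \<partial>M) = \<mu>) \<and>
     (\<exists>\<gamma>. \<forall>n h. (\<integral>\<omega>. X (n + h) \<omega> * X n \<omega> \<partial>M) = \<gamma> h)"

definition zero_mean :: "'a measure \<Rightarrow> (int \<Rightarrow> 'a \<Rightarrow> real) \<Rightarrow> bool" where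
  "zero_mean M X \<longleftrightarrow> (\<forall>n. (\<integral>\<omega>. X n \<omega> \<partial>M) = 0)"

definition autocov :: "'a measure \<Rightarrow> (int \<Rightarrow> 'a \<Rightarrow> real) \<Rightarrow> int \<Rightarrow> real" where
  "autocov M X h = (\<integral>\<omega>. X h \<omega> * X 0 \<omega> \<partial>M)"

definition vec_second_order_stationary ::
    "'a measure \<Rightarrow> (int \<Rightarrow> 'a \<Rightarrow> real ^ 'm::finite) \<Rightarrow> bool" where
  "vec_second_order_stationary M Y \<longleftrightarrow>
     (\<forall>n. Y n \<in> borel_measurable M) \<and>
     (\<forall>n. integrable M (\<lambda>\<omega>. (norm (Y n \<omega>))\<^sup>2)) \<and>
     (\<exists>\<mu>. \<forall>n. (\<integral>\<omega>. Y n \<omega> \<partial>M) = \<mu>) \<and>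
     (\<exists>\<Gamma> :: int \<Rightarrow> real ^ 'm ^ 'm. \<forall>n h j k.
        (\<integral>\<omega>. Y (n + h) \<omega> $ j * Y n \<omega> $ k \<partial>M) = \<Gamma> h $ j $ k)"

definition vec_zero_mean :: "'a measure \<Rightarrow> (int \<Rightarrow> 'a \<Rightarrow> real ^ 'm::finite) \<Rightarrow> bool" where
  "vec_zero_mean M Y \<longleftrightarrow> (\<forall>n. (\<integral>\<omega>. Y n \<omega> \<partial>M) = 0)"

definition matrix_autocov ::
    "'a measure \<Rightarrow> (int \<Rightarrow> 'a \<Rightarrow> real ^ 'm::finite) \<Rightarrow> int \<Rightarrow> real ^ 'm ^ 'm" where
  "matrix_autocov M Y h = (\<chi> j k. \<integral>\<omega>. Y h \<omega> $ j * Y 0 \<omega> $ k \<partial>M)"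

text \<open>
  The relation \<open>\<Gamma>(h) \<sim> R h\<^sup>2\<^sup>d\<^sup>-\<^sup>1\<close>, entrywise and in additive form, so that a zero entry of
  \<open>R\<close> means that the corresponding entry of \<open>\<Gamma>\<close> is \<open>o(h\<^sup>2\<^sup>d\<^sup>-\<^sup>1)\<close>.
\<close>

definition long_memory_form ::
    "(int \<Rightarrow> real ^ 'm::finite ^ 'm) \<Rightarrow> real ^ 'm ^ 'm \<Rightarrow> real \<Rightarrow> bool" where
  "long_memory_form \<Gamma> R d \<longleftrightarrow>
     (\<forall>j k. (\<lambda>h. \<Gamma> h $ j $ k - R $ j $ k * real_of_int h powr (2 * d - 1))
              \<in> o[at_top](\<lambda>h. real_of_int h powr (2 * d - 1)))"

definition cyclical_form :: "(int \<Rightarrow> real) \<Rightarrow> real \<Rightarrow> real \<Rightarrow> real \<Rightarrow> real \<Rightarrow> bool" where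
  "cyclical_form \<gamma> d lam \<phi> c \<longleftrightarrow>
     (\<lambda>h. \<gamma> h - c * cos (lam * real_of_int h + \<phi>) * real_of_int h powr (2 * d - 1))
       \<in> o[at_top](\<lambda>h. real_of_int h powr (2 * d - 1))"

definition cyclical_long_memory ::
    "'a measure \<Rightarrow> (int \<Rightarrow> 'a \<Rightarrow> real) \<Rightarrow> real \<Rightarrow> real \<Rightarrow> real \<Rightarrow> bool" where
  "cyclical_long_memory M X d lam \<phi> \<longleftrightarrow>
     second_order_stationary M X \<and> zero_mean M X \<and>
     0 < d \<and> d < 1 / 2 \<and> 0 < lam \<and> lam < pi \<and> - pi / 2 < \<phi> \<and> \<phi> < pi / 2 \<and>
     (\<exists>c>0. cyclical_form (autocov M X) d lam \<phi> c)"

end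

theory Submission
  imports Defs
begin

text \<open>
  The two symmetries of \<open>\<gamma>\<^sub>Y\<close> are exactly what makes the products of sines and cosines in
  \<open>\<gamma>\<^sub>X\<close> at the times \<open>n + h\<close> and \<open>n\<close> combine, by the subtraction formulas, into functions of
  \<open>h\<close> alone. The asymptotic form then comes from writing \<open>(r\<^sub>0, - r\<^sub>1)\<close> in polar coordinates
  \<open>(c, \<phi>)\<close> and applying the addition formula for the cosine; the factors \<open>cos (\<lambda>\<^sub>0 h)\<close> and
  \<open>sin (\<lambda>\<^sub>0 h)\<close> are bounded, so they preserve the error terms.
\<close>

lemma borel_measurable_vec_nth [measurable (raw)]:
  fixes U :: "'a \<Rightarrow> real ^ 'm::finite"
  assumes "U \<in> borel_measurable M"
  shows "(\<lambda>\<omega>. U \<omega> $ j) \<in> borel_measurable M"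
  using borel_measurable_continuous_onI[OF linear_continuous_on[OF bounded_linear_vec_nth]] assms
  by (rule measurable_compose_rev)

text \<open>Each coordinate is at most the norm, and \<open>2 * x * y \<le> x^2 + y^2\<close> then
  dominates the product by the integrable sum of the two squared norms.\<close>

lemma integrable_vec_nth_mult:
  fixes U V :: "'a \<Rightarrow> real ^ 'm::finite"
  assumes [measurable]: "U \<in> borel_measurable M" "V \<in> borel_measurable M"
    and "integrable M (\<lambda>\<omega>. (norm (U \<omega>))\<^sup>2)" "integrable M (\<lambda>\<omega>. (norm (V \<omega>))\<^sup>2)"
  shows "integrable M (\<lambda>\<omega>. U \<omega> $ j * V \<omega> $ k)"
proof (rule Bochner_Integration.integrable_bound)
  show "integrable M (\<lambda>\<omega>. (norm (U \<omega>))\<^sup>2 + (norm (V \<omega>))\<^sup>2)"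
    using assms by simp
  show "(\<lambda>\<omega>. U \<omega> $ j * V \<omega> $ k) \<in> borel_measurable M"
    by (intro borel_measurable_times borel_measurable_vec_nth assms)
  have "norm (U \<omega> $ j * V \<omega> $ k) \<le> norm ((norm (U \<omega>))\<^sup>2 + (norm (V \<omega>))\<^sup>2)" for \<omega>
  proof -
    have "\<bar>U \<omega> $ j * V \<omega> $ k\<bar> \<le> norm (U \<omega>) * norm (V \<omega>)"
      unfolding abs_mult by (intro mult_mono component_le_norm_cart) auto
    also have "\<dots> \<le> 2 * norm (U \<omega>) * norm (V \<omega>)"
      by simp
    also have "\<dots> \<le> (norm (U \<omega>))\<^sup>2 + (norm (V \<omega>))\<^sup>2"
      by (rule sum_squares_bound)
    finally show ?thesis by simp
  qed
  then show "AE \<omega> in M. norm (U \<omega> $ j * V \<omega> $ k) \<le> norm ((norm (U \<omega>))\<^sup>2 + (norm (V \<omega>))\<^sup>2)"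
    by simp
qed

text \<open>Constants are integrable over a finite measure, and \<open>2 * x \<le> x^2 + 1\<close>
  dominates the norm by one plus its square. This makes the means of \<open>Y\<close> genuine
  integrals.\<close>

lemma (in finite_measure) integrable_of_integrable_norm_square:
  fixes U :: "'a \<Rightarrow> 'b::{banach, second_countable_topology}"
  assumes "U \<in> borel_measurable M" "integrable M (\<lambda>\<omega>. (norm (U \<omega>))\<^sup>2)"
  shows "integrable M U"
proof (rule Bochner_Integration.integrable_bound)
  show "integrable M (\<lambda>\<omega>. 1 + (norm (U \<omega>))\<^sup>2)"
    using assms by simp
  have "norm (U \<omega>) \<le> norm (1 + (norm (U \<omega>))\<^sup>2)" for \<omega>
  proof -
    have "2 * norm (U \<omega>) \<le> (norm (U \<omega>))\<^sup>2 + 1"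
      using sum_squares_bound[of "norm (U \<omega>)" 1] by simp
    then have "norm (U \<omega>) \<le> 1 + (norm (U \<omega>))\<^sup>2"
      using norm_ge_zero[of "U \<omega>"] by linarith
    then show ?thesis
      by simp
  qed
  then show "AE \<omega> in M. norm (U \<omega>) \<le> norm (1 + (norm (U \<omega>))\<^sup>2)"
    by simp
qed (use assms in simp)

lemma integral_vec_nth:
  fixes U :: "'a \<Rightarrow> real ^ 'm::finite"
  assumes "integrable M U"
  shows "integrable M (\<lambda>\<omega>. U \<omega> $ j)" "(\<integral>\<omega>. U \<omega> $ j \<partial>M) = (\<integral>\<omega>. U \<omega> \<partial>M) $ j"
  using integrable_bounded_linear[OF bounded_linear_vec_nth assms]
    integral_bounded_linear[OF bounded_linear_vec_nth assms] by auto

text \<open>The covariance function in the definition of stationarity is only asserted to exist;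
  evaluating it at \<open>n = 0\<close> identifies it with \<open>matrix_autocov\<close>.\<close>

lemma vec_second_order_stationary_autocov:
  fixes Y :: "int \<Rightarrow> 'a \<Rightarrow> real ^ 'm::finite"
  assumes "vec_second_order_stationary M Y"
  shows "(\<integral>\<omega>. Y (n + h) \<omega> $ j * Y n \<omega> $ k \<partial>M) = matrix_autocov M Y h $ j $ k"
proof -
  obtain \<Gamma> :: "int \<Rightarrow> real ^ 'm ^ 'm" where
    \<Gamma>: "\<And>n h j k. (\<integral>\<omega>. Y (n + h) \<omega> $ j * Y n \<omega> $ k \<partial>M) = \<Gamma> h $ j $ k"
    using assms unfolding vec_second_order_stationary_def by blast
  show ?thesis
    using \<Gamma>[of n h j k] \<Gamma>[of 0 h j k] by (simp add: matrix_autocov_def)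
qed

lemma smallo_bounded_mult:
  fixes f g b :: "'a \<Rightarrow> real"
  assumes "f \<in> o[F](g)" and "\<And>x. \<bar>b x\<bar> \<le> 1"
  shows "(\<lambda>x. b x * f x) \<in> o[F](g)"
proof -
  have "b \<in> O[F](\<lambda>_. 1)"
    by (rule bigoI[of _ 1]) (use assms in auto)
  from landau_o.big_small_mult[OF this assms(1)] show ?thesis
    by simp
qed

text \<open>For \<open>a > 0\<close> the point \<open>(a, b)\<close> has its argument in the open
  interval from \<open>- pi / 2\<close> to \<open>pi / 2\<close>, where the sine is injective, so
  \<open>arcsin\<close> recovers it. The use below is \<open>a = r0\<close>,
  \<open>b = - r1\<close>.\<close>

lemma polar_coordinates_right_half_plane:
  fixes a b r \<theta> :: real
  assumes "a > 0" "r > 0" "- pi / 2 < \<theta>" "\<theta> < pi / 2"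
  shows "r = sqrt (a\<^sup>2 + b\<^sup>2) \<and> \<theta> = arcsin (b / sqrt (a\<^sup>2 + b\<^sup>2))
         \<longleftrightarrow> a = r * cos \<theta> \<and> b = r * sin \<theta>"
proof
  assume L: "r = sqrt (a\<^sup>2 + b\<^sup>2) \<and> \<theta> = arcsin (b / sqrt (a\<^sup>2 + b\<^sup>2))"
  have r2: "r\<^sup>2 = a\<^sup>2 + b\<^sup>2"
    by (simp add: L[THEN conjunct1])
  have \<theta>: "\<theta> = arcsin (b / r)"
    using L by metis
  have "\<bar>b\<bar> \<le> r"
    unfolding L[THEN conjunct1] by (simp add: real_le_rsqrt)
  then have bnd: "- 1 \<le> b / r" "b / r \<le> 1"
    using assms(2) by (auto simp: field_simps)
  have "(a / r)\<^sup>2 + (b / r)\<^sup>2 = 1"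
    using assms(2) by (simp add: power_divide flip: add_divide_distrib r2)
  then have "1 - (b / r)\<^sup>2 = (a / r)\<^sup>2"
    by linarith
  \<comment> \<open>The cosine of an arcsine is a nonnegative square root, so only the absolute
    value appears; \<open>a > 0\<close> removes it afterwards.\<close>
  then have "cos \<theta> = \<bar>a / r\<bar>"
    unfolding \<theta> cos_arcsin[OF bnd] by (simp only: real_sqrt_abs)
  moreover have "sin \<theta> = b / r"
    unfolding \<theta> by (rule sin_arcsin[OF bnd])
  ultimately have "cos \<theta> = a / r" "sin \<theta> = b / r"
    using assms(1,2) by auto
  then show "a = r * cos \<theta> \<and> b = r * sin \<theta>"
    using assms(2) by simp
next
  assume R: "a = r * cos \<theta> \<and> b = r * sin \<theta>"
  have "a\<^sup>2 + b\<^sup>2 = r\<^sup>2 * ((cos \<theta>)\<^sup>2 + (sin \<theta>)\<^sup>2)"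
    using R by (simp add: power_mult_distrib algebra_simps del: sin_cos_squared_add2)
  then have "sqrt (a\<^sup>2 + b\<^sup>2) = r"
    using assms(2) by simp
  \<comment> \<open>Here \<open>b / r = sin \<theta>\<close>, and the bounds on
    \<open>\<theta>\<close> let \<open>arcsin\<close> invert the sine.\<close>
  then show "r = sqrt (a\<^sup>2 + b\<^sup>2) \<and> \<theta> = arcsin (b / sqrt (a\<^sup>2 + b\<^sup>2))"
    using R assms by (simp add: arcsin_sin)
qed

theorem proposition3p3:
  fixes M :: "'a measure"
    and Y :: "int \<Rightarrow> 'a \<Rightarrow> real ^ 2"
    and X :: "int \<Rightarrow> 'a \<Rightarrow> real"
    and d r0 r1 lam c \<phi> :: real
  assumes "prob_space M"
    and "vec_second_order_stationary M Y"
    and "vec_zero_mean M Y"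
    and "\<And>h. matrix_autocov M Y h $ 1 $ 1 = matrix_autocov M Y h $ 2 $ 2"
    and "\<And>h. matrix_autocov M Y h $ 1 $ 2 = - (matrix_autocov M Y h $ 2 $ 1)"
    and "0 < d" and "d < 1 / 2" and "r0 > 0"
    and "long_memory_form (matrix_autocov M Y) (vector [vector [r0, - r1], vector [r1, r0]]) d"
    and "0 < lam" and "lam < pi"
    and X: "\<And>n \<omega>. X n \<omega> =
              cos (lam * real_of_int n) * Y n \<omega> $ 1 + sin (lam * real_of_int n) * Y n \<omega> $ 2"
    and c: "c = sqrt (r0\<^sup>2 + r1\<^sup>2)"
    and \<phi>: "\<phi> = arcsin (- r1 / sqrt (r0\<^sup>2 + r1\<^sup>2))"
  shows "second_order_stationary M X
    \<and> (\<forall>h. autocov M X h = cos (lam * real_of_int h) * matrix_autocov M Y h $ 1 $ 1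
                          - sin (lam * real_of_int h) * matrix_autocov M Y h $ 1 $ 2)
    \<and> cyclical_long_memory M X d lam \<phi>
    \<and> c > 0 \<and> cyclical_form (autocov M X) d lam \<phi> c
    \<and> r0 = c * cos \<phi> \<and> r1 = - c * sin \<phi>
    \<and> (\<forall>c' \<phi>'. c' > 0 \<and> - pi / 2 < \<phi>' \<and> \<phi>' < pi / 2 \<longrightarrow>
          (c' = sqrt (r0\<^sup>2 + r1\<^sup>2) \<and> \<phi>' = arcsin (- r1 / sqrt (r0\<^sup>2 + r1\<^sup>2))
           \<longleftrightarrow> r0 = c' * cos \<phi>' \<and> r1 = - c' * sin \<phi>'))"
proof -
  interpret prob_space M by fact
  note stat = assms(2)
  define \<Gamma> where "\<Gamma> = matrix_autocov M Y"
  have [measurable]: "Y n \<in> borel_measurable M" for n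
    using stat by (simp add: vec_second_order_stationary_def)
  have sq: "integrable M (\<lambda>\<omega>. (norm (Y n \<omega>))\<^sup>2)" for n
    using stat by (simp add: vec_second_order_stationary_def)
  have prod: "integrable M (\<lambda>\<omega>. Y m \<omega> $ j * Y n \<omega> $ k)" for m n j k
    by (intro integrable_vec_nth_mult sq) measurable
  have int: "integrable M (Y n)" for n
    by (rule integrable_of_integrable_norm_square[OF _ sq]) measurable
  have mean: "(\<integral>\<omega>. Y n \<omega> $ j \<partial>M) = 0" for n j
    using assms(3) integral_vec_nth(2)[OF int] by (simp add: vec_zero_mean_def)

  have XX: "X m \<omega> * X n \<omega> =
      cos (lam * m) * cos (lam * n) * (Y m \<omega> $ 1 * Y n \<omega> $ 1)
      + cos (lam * m) * sin (lam * n) * (Y m \<omega> $ 1 * Y n \<omega> $ 2)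
      + sin (lam * m) * cos (lam * n) * (Y m \<omega> $ 2 * Y n \<omega> $ 1)
      + sin (lam * m) * sin (lam * n) * (Y m \<omega> $ 2 * Y n \<omega> $ 2)" for m n \<omega>
    by (simp add: X algebra_simps)
  have Xint: "integrable M (\<lambda>\<omega>. X m \<omega> * X n \<omega>)" for m n
    unfolding XX by (intro Bochner_Integration.integrable_add integrable_mult_right prod)
  have Xmean: "(\<integral>\<omega>. X n \<omega> \<partial>M) = 0" for n
    using integral_vec_nth(1)[OF int] by (simp add: X mean)
  have Xcov: "(\<integral>\<omega>. X (n + h) \<omega> * X n \<omega> \<partial>M)
      = cos (lam * h) * \<Gamma> h $ 1 $ 1 - sin (lam * h) * \<Gamma> h $ 1 $ 2" for n h
  proof -
    let ?a = "lam * real_of_int (n + h)" and ?b = "lam * real_of_int n"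
    have "(\<integral>\<omega>. X (n + h) \<omega> * X n \<omega> \<partial>M)
        = cos ?a * cos ?b * \<Gamma> h $ 1 $ 1 + cos ?a * sin ?b * \<Gamma> h $ 1 $ 2
        + sin ?a * cos ?b * \<Gamma> h $ 2 $ 1 + sin ?a * sin ?b * \<Gamma> h $ 2 $ 2"
      unfolding XX \<Gamma>_def
      by (simp add: prod vec_second_order_stationary_autocov[OF stat] del: of_int_add)
    \<comment> \<open>Substituting the symmetries of \<open>\<Gamma>\<close>, the
      \<open>(1,1)\<close> entry collects \<open>cos ?a * cos ?b + sin ?a * sin ?b\<close>, and the
      \<open>(1,2)\<close> entry collects \<open>cos ?a * sin ?b - sin ?a * cos ?b\<close>, which is
      \<open>- sin (?a - ?b)\<close>.\<close>
    also have "\<dots> = cos (?a - ?b) * \<Gamma> h $ 1 $ 1 - sin (?a - ?b) * \<Gamma> h $ 1 $ 2"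
      using assms(4,5)[of h] unfolding \<Gamma>_def[symmetric] cos_diff sin_diff
      by (simp add: algebra_simps del: of_int_add)
    also have "?a - ?b = lam * h"
      by (simp add: algebra_simps)
    finally show ?thesis .
  qed
  have X_stat: "second_order_stationary M X"
    unfolding second_order_stationary_def
  proof (intro conjI allI)
    show "X n \<in> borel_measurable M" for n
      unfolding X by measurable
    show "integrable M (\<lambda>\<omega>. (X n \<omega>)\<^sup>2)" for n
      using Xint[of n n] by (simp add: power2_eq_square)
  qed (use Xmean Xcov in auto)
  have cov: "autocov M X h = cos (lam * h) * \<Gamma> h $ 1 $ 1 - sin (lam * h) * \<Gamma> h $ 1 $ 2" for h
    using Xcov[of 0 h] by (simp add: autocov_def)

  have c_pos: "c > 0"
    using \<open>r0 > 0\<close> by (simp add: c add_pos_nonneg)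
  \<comment> \<open>The inequality is strict because \<open>r0 > 0\<close>; this keeps the phase
    away from the endpoints \<open>- pi / 2\<close> and \<open>pi / 2\<close>.\<close>
  have "\<bar>- r1 / c\<bar> < 1"
  proof -
    have "\<bar>r1\<bar> = sqrt (r1\<^sup>2)"
      by simp
    also have "\<dots> < c"
      using \<open>r0 > 0\<close> unfolding c by (intro real_sqrt_less_mono) simp
    finally show ?thesis
      using c_pos by simp
  qed
  then have "- 1 < - r1 / c" "- r1 / c < 1"
    unfolding abs_less_iff by linarith+
  from arcsin_lt_bounded[OF this]
  have \<phi>_bounds: "- pi / 2 < \<phi>" "\<phi> < pi / 2"
    unfolding \<phi> c by auto
  \<comment> \<open>Kept for arbitrary \<open>c'\<close> and \<open>\<phi>'\<close>: it is the
    claimed equivalence, and its forward direction at \<open>c\<close>, \<open>\<phi>\<close> yields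
    the formulas for \<open>r0\<close> and \<open>r1\<close>.\<close>
  have polar: "c' = sqrt (r0\<^sup>2 + r1\<^sup>2) \<and> \<phi>' = arcsin (- r1 / sqrt (r0\<^sup>2 + r1\<^sup>2))
      \<longleftrightarrow> r0 = c' * cos \<phi>' \<and> r1 = - c' * sin \<phi>'"
    if "c' > 0" "- pi / 2 < \<phi>'" "\<phi>' < pi / 2" for c' \<phi>'
    using polar_coordinates_right_half_plane[OF \<open>r0 > 0\<close> that, of "- r1"] by auto
  have r: "r0 = c * cos \<phi>" "r1 = - c * sin \<phi>"
    using polar[OF c_pos \<phi>_bounds] c \<phi> by auto

  let ?p = "\<lambda>h. real_of_int h powr (2 * d - 1)"
  have E1: "(\<lambda>h. \<Gamma> h $ 1 $ 1 - r0 * ?p h) \<in> o[at_top](?p)"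
    and E2: "(\<lambda>h. \<Gamma> h $ 1 $ 2 - - r1 * ?p h) \<in> o[at_top](?p)"
    using assms(9)[unfolded long_memory_form_def, rule_format, of 1 1]
      assms(9)[unfolded long_memory_form_def, rule_format, of 1 2]
    by (simp_all add: \<Gamma>_def)
  \<comment> \<open>The errors of the two entries are combined with the same weights as the entries
    themselves in \<open>cov\<close>.\<close>
  have "(\<lambda>h. cos (lam * real_of_int h) * (\<Gamma> h $ 1 $ 1 - r0 * ?p h)
      - sin (lam * real_of_int h) * (\<Gamma> h $ 1 $ 2 - - r1 * ?p h)) \<in> o[at_top](?p)"
    by (rule sum_in_smallo(2)[OF smallo_bounded_mult[OF E1] smallo_bounded_mult[OF E2]]) simp_all
  \<comment> \<open>The leading coefficient is
    \<open>r0 * cos (lam * h) + r1 * sin (lam * h)\<close>. In polar form it becomes \<open>c * (cos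
    (lam * h) * cos \<phi> - sin (lam * h) * sin \<phi>)\<close>, that is,
    \<open>c * cos (lam * h + \<phi>)\<close>.\<close>
  also have "(\<lambda>h. cos (lam * real_of_int h) * (\<Gamma> h $ 1 $ 1 - r0 * ?p h)
      - sin (lam * real_of_int h) * (\<Gamma> h $ 1 $ 2 - - r1 * ?p h))
      = (\<lambda>h. autocov M X h - c * cos (lam * real_of_int h + \<phi>) * ?p h)"
    unfolding cov cos_add r by (simp add: algebra_simps)
  finally have form: "cyclical_form (autocov M X) d lam \<phi> c"
    unfolding cyclical_form_def .
  then have "cyclical_long_memory M X d lam \<phi>"
    unfolding cyclical_long_memory_def zero_mean_def
    using X_stat Xmean assms(6,7,10,11) \<phi>_bounds c_pos by blast
  with X_stat cov c_pos form r polar show ?thesis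
    unfolding \<Gamma>_def by blast
qed

end
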